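(* Let $F_n$ be the free group of rank $n$, let $C<F_n$ be a cyclic subgroup, and let $L$ be a set of prime numbers such that $L^\perp\neq\emptyset$. If $C$ is closed under $l$-roots for every $l\in L$, then $C$ is closed in the topology on $F_n$ generated by the union of the pro-$p$ topologies for $p$ ranging over $L^\perp$.
   Context: $L^\perp$ denotes the set of primes $p$ with $\gcd(p,l)=1$ for all $l\in L$. A subgroup $H$ of a group $G$ is closed under $l$-roots if for every $g\in G$, $g^l\in H$ implies $g\in H$. For a prime $p$, the pro-$p$ topology on $F_n$ is the group topology whose basic open sets are the cosets of normal subgroups of $F_n$ of finite index a power of $p$. *)

theory Defs
  imports
    "HOL-Algebra.Elementary_Groups"
    "HOL-Analysis.Abstract_Topology"
    "HOL-Computational_Algebra.Primes"
begin

section \<open>Free groups\<close>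

text \<open>
  A letter \<open>(x, True)\<close> stands for the generator \<open>x\<close>, and \<open>(x, False)\<close> for its inverse.  Elements of the
  free group are represented by their normal forms, the reduced words.
\<close>

type_synonym 'a letter = "'a \<times> bool"

definition flip :: "'a letter \<Rightarrow> 'a letter"
  where "flip a = (fst a, \<not> snd a)"

definition reduced :: "'a letter list \<Rightarrow> bool"
  where "reduced w \<longleftrightarrow> successively (\<lambda>a b. b \<noteq> flip a) w"

definition push :: "'a letter \<Rightarrow> 'a letter list \<Rightarrow> 'a letter list"
  where "push a w = (if w \<noteq> [] \<and> hd w = flip a then tl w else a # w)"

text \<open>
  For reduced \<open>v\<close>, \<open>foldr push u v\<close> is the reduced form of the concatenation \<open>u @ v\<close>.
\<close>

definition free_group :: "'a set \<Rightarrow> 'a letter list monoid"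
  where "free_group S =
    \<lparr>carrier = {w. set w \<subseteq> S \<times> UNIV \<and> reduced w},
     monoid.mult = (\<lambda>u v. foldr push u v),
     monoid.one = []\<rparr>"

abbreviation free_group_of_rank :: "nat \<Rightarrow> nat letter list monoid"
  where "free_group_of_rank n \<equiv> free_group {..<n}"

lemma flip_flip [simp]: "flip (flip a) = a"
  by (simp add: flip_def)

lemma flip_neq [simp]: "flip a \<noteq> a" "a \<noteq> flip a"
  by (auto simp: flip_def prod_eq_iff)

lemma flip_eq_iff [simp]: "flip a = flip b \<longleftrightarrow> a = b"
  by (metis flip_flip)

lemma flip_in_iff [simp]: "flip a \<in> S \<times> UNIV \<longleftrightarrow> a \<in> S \<times> UNIV"
  by (cases a) (auto simp: flip_def)

lemma reduced_Nil [simp]: "reduced []"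
  by (simp add: reduced_def)

lemma reduced_Cons: "reduced (a # w) \<longleftrightarrow> reduced w \<and> (w \<noteq> [] \<longrightarrow> hd w \<noteq> flip a)"
  by (cases w) (auto simp: reduced_def)

lemma reduced_push: "reduced w \<Longrightarrow> reduced (push a w)"
  by (cases w) (auto simp: push_def reduced_Cons)

lemma push_push_flip: "reduced w \<Longrightarrow> push a (push (flip a) w) = w"
  by (cases w; cases "tl w") (auto simp: push_def reduced_Cons)

lemma set_push: "set (push a w) \<subseteq> insert a (set w)"
  by (cases w) (auto simp: push_def)

lemma reduced_foldr_push: "reduced v \<Longrightarrow> reduced (foldr push u v)"
  by (induction u) (auto intro: reduced_push)

lemma set_foldr_push: "set (foldr push u v) \<subseteq> set u \<union> set v"
proof (induction u)
  case (Cons a u)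
  then show ?case using set_push[of a "foldr push u v"] by auto
qed simp

lemma foldr_push_reduced: "reduced w \<Longrightarrow> foldr push w [] = w"
  by (induction w) (auto simp: reduced_Cons push_def)

lemma foldr_push_push:
  assumes "reduced v" "reduced w"
  shows "foldr push (push a v) w = push a (foldr push v w)"
proof (cases "v \<noteq> [] \<and> hd v = flip a")
  case True
  then obtain v' where v: "v = flip a # v'" by (cases v) auto
  have "reduced (foldr push v' w)" using assms by (intro reduced_foldr_push)
  then show ?thesis by (simp add: v push_push_flip) (simp add: push_def)
next
  case False
  then show ?thesis by (auto simp: push_def[of a v])
qed

lemma foldr_push_assoc:
  assumes "reduced v" "reduced w"
  shows "foldr push (foldr push u v) w = foldr push u (foldr push v w)"
  using assms by (induction u) (auto simp: foldr_push_push reduced_foldr_push)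

lemma foldr_push_inverse: "reduced v \<Longrightarrow> foldr push (rev (map flip w)) (foldr push w v) = v"
proof (induction w arbitrary: v)
  case (Cons a w)
  have "reduced (foldr push w v)" using Cons.prems by (rule reduced_foldr_push)
  then have "push (flip a) (push a (foldr push w v)) = foldr push w v"
    using push_push_flip[of _ "flip a"] by simp
  then show ?case using Cons by simp
qed simp

lemma group_free_group: "group (free_group S)"
proof (rule groupI)
  fix x y assume "x \<in> carrier (free_group S)" "y \<in> carrier (free_group S)"
  then show "x \<otimes>\<^bsub>free_group S\<^esub> y \<in> carrier (free_group S)"
    using set_foldr_push[of x y] by (auto simp: free_group_def intro: reduced_foldr_push)
next
  fix x assume x: "x \<in> carrier (free_group S)"
  let ?y = "foldr push (rev (map flip x)) []"
  have "set (rev (map flip x)) \<subseteq> S \<times> UNIV"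
    using x by (auto simp: free_group_def flip_def)
  then have y: "?y \<in> carrier (free_group S)"
    using subset_trans[OF set_foldr_push[of "rev (map flip x)" "[]"], of "S \<times> UNIV"]
    by (simp add: free_group_def reduced_foldr_push)
  have "foldr push ?y x = foldr push (rev (map flip x)) x"
    using x foldr_push_assoc[of "[]" x "rev (map flip x)"] by (simp add: free_group_def)
  also have "\<dots> = []"
    using x foldr_push_inverse[of "[]" x] by (simp add: free_group_def foldr_push_reduced)
  finally have "?y \<otimes>\<^bsub>free_group S\<^esub> x = \<one>\<^bsub>free_group S\<^esub>"
    by (simp add: free_group_def)
  then show "\<exists>y\<in>carrier (free_group S). y \<otimes>\<^bsub>free_group S\<^esub> x = \<one>\<^bsub>free_group S\<^esub>"
    using y by blast
qed (auto simp: free_group_def foldr_push_assoc)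

text \<open>The universal property: \<open>free_group S\<close> is free on the one-letter words \<open>[(x, True)]\<close>.\<close>

definition eval_letter :: "('b, 'c) monoid_scheme \<Rightarrow> ('a \<Rightarrow> 'b) \<Rightarrow> 'a letter \<Rightarrow> 'b"
  where "eval_letter G f a = (if snd a then f (fst a) else inv\<^bsub>G\<^esub> (f (fst a)))"

definition eval_word :: "('b, 'c) monoid_scheme \<Rightarrow> ('a \<Rightarrow> 'b) \<Rightarrow> 'a letter list \<Rightarrow> 'b"
  where "eval_word G f w = foldr (\<lambda>a g. eval_letter G f a \<otimes>\<^bsub>G\<^esub> g) w \<one>\<^bsub>G\<^esub>"

context group
begin

lemma eval_letter_closed: "f \<in> S \<rightarrow> carrier G \<Longrightarrow> a \<in> S \<times> UNIV \<Longrightarrow> eval_letter G f a \<in> carrier G"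
  by (auto simp: eval_letter_def)

lemma eval_letter_flip:
  "f \<in> S \<rightarrow> carrier G \<Longrightarrow> a \<in> S \<times> UNIV \<Longrightarrow> eval_letter G f (flip a) = inv (eval_letter G f a)"
  by (auto simp: eval_letter_def flip_def Pi_iff)

lemma eval_word_closed: "f \<in> S \<rightarrow> carrier G \<Longrightarrow> set w \<subseteq> S \<times> UNIV \<Longrightarrow> eval_word G f w \<in> carrier G"
  by (induction w) (auto simp: eval_word_def intro!: m_closed dest: eval_letter_closed)

lemma eval_word_push:
  assumes f: "f \<in> S \<rightarrow> carrier G" and a: "a \<in> S \<times> UNIV" and w: "set w \<subseteq> S \<times> UNIV"
  shows "eval_word G f (push a w) = eval_letter G f a \<otimes> eval_word G f w"
proof (cases "w \<noteq> [] \<and> hd w = flip a")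
  case True
  then obtain w' where w': "w = flip a # w'" by (cases w) auto
  have c: "eval_letter G f a \<in> carrier G" "eval_word G f w' \<in> carrier G"
    using eval_letter_closed[OF f a] eval_word_closed[OF f, of w'] w w' by auto
  have "eval_word G f w = inv (eval_letter G f a) \<otimes> eval_word G f w'"
    by (simp add: w' eval_word_def eval_letter_flip[OF f a])
  then show ?thesis using c by (simp add: w' push_def m_assoc[symmetric])
next
  case False
  then show ?thesis by (auto simp: push_def eval_word_def)
qed

lemma eval_word_foldr_push:
  assumes f: "f \<in> S \<rightarrow> carrier G" and v: "set v \<subseteq> S \<times> UNIV"
  shows "set u \<subseteq> S \<times> UNIV \<Longrightarrow> eval_word G f (foldr push u v) = eval_word G f u \<otimes> eval_word G f v"
proof (induction u)
  case Nil
  then show ?case using eval_word_closed[OF f v] by (simp add: eval_word_def[of _ _ "[]"])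
next
  case (Cons a u)
  have s: "set (foldr push u v) \<subseteq> S \<times> UNIV" using set_foldr_push[of u v] Cons v by auto
  have c: "eval_letter G f a \<in> carrier G" "eval_word G f u \<in> carrier G"
    using eval_letter_closed[OF f, of a] eval_word_closed[OF f, of u] Cons.prems by auto
  have "eval_word G f (a # u) = eval_letter G f a \<otimes> eval_word G f u"
    by (simp add: eval_word_def)
  then show ?case
    using eval_word_push[OF f _ s, of a] Cons c eval_word_closed[OF f v] by (simp add: m_assoc)
qed

theorem free_group_universal:
  assumes f: "f \<in> S \<rightarrow> carrier G"
  shows "eval_word G f \<in> hom (free_group S) G"
    and "x \<in> S \<Longrightarrow> eval_word G f [(x, True)] = f x"
    and "h \<in> hom (free_group S) G \<Longrightarrow> (\<And>x. x \<in> S \<Longrightarrow> h [(x, True)] = f x) \<Longrightarrow>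
           w \<in> carrier (free_group S) \<Longrightarrow> h w = eval_word G f w"
proof -
  show "eval_word G f \<in> hom (free_group S) G"
    by (auto simp: hom_def free_group_def eval_word_foldr_push[OF f] eval_word_closed[OF f])
  show "eval_word G f [(x, True)] = f x" if "x \<in> S"
    using that f by (auto simp: eval_word_def eval_letter_def Pi_iff)
  assume h: "h \<in> hom (free_group S) G" and hf: "\<And>x. x \<in> S \<Longrightarrow> h [(x, True)] = f x"
  interpret F: group "free_group S" by (rule group_free_group)
  interpret h: group_hom "free_group S" G h
    using h F.is_group is_group by (simp add: group_hom_def group_hom_axioms_def)
  have c: "[a] \<in> carrier (free_group S)" if "a \<in> S \<times> UNIV" for a
    using that by (auto simp: free_group_def reduced_Cons)
  have letter: "h [a] = eval_letter G f a" if aS: "a \<in> S \<times> UNIV" for a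
  proof -
    obtain x e where a: "a = (x, e)" "x \<in> S" using aS by (cases a) auto
    show "h [a] = eval_letter G f a"
    proof (cases e)
      case True then show ?thesis using a hf by (simp add: eval_letter_def)
    next
      case False
      have "[(x, False)] \<otimes>\<^bsub>free_group S\<^esub> [(x, True)] = \<one>\<^bsub>free_group S\<^esub>"
        by (simp add: free_group_def push_def flip_def)
      then have "[(x, False)] = inv\<^bsub>free_group S\<^esub> [(x, True)]"
        using c[of "(x, True)"] c[of "(x, False)"] a by (intro F.inv_equality[symmetric]) auto
      then show ?thesis using a False c[of "(x, True)"] hf by (simp add: eval_letter_def)
    qed
  qed
  show "h w = eval_word G f w" if "w \<in> carrier (free_group S)" using that
  proof (induction w)
    case Nil
    then show ?case using h.hom_one by (simp add: free_group_def eval_word_def)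
  next
    case (Cons a w)
    have w: "w \<in> carrier (free_group S)" and a: "a \<in> S \<times> UNIV"
      using Cons.prems by (auto simp: free_group_def reduced_Cons)
    have "a # w = [a] \<otimes>\<^bsub>free_group S\<^esub> w"
      using Cons.prems by (auto simp: free_group_def reduced_Cons push_def)
    then have "h (a # w) = h [a] \<otimes> h w" using h.hom_mult c[OF a] w by simp
    then show ?case using Cons.IH[OF w] letter[OF a] by (simp add: eval_word_def)
  qed
qed

end


section \<open>Pro-p topologies and closure under roots\<close>

definition pro_p_base :: "('a, 'b) monoid_scheme \<Rightarrow> nat \<Rightarrow> 'a set set"
  where "pro_p_base G p =
    {U. \<exists>N k. N \<lhd> G \<and> finite (rcosets\<^bsub>G\<^esub> N) \<and> card (rcosets\<^bsub>G\<^esub> N) = p ^ k \<and> U \<in> rcosets\<^bsub>G\<^esub> N}"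

text \<open>
  If \<open>M\<close> and \<open>N\<close> are normal of \<open>p\<close>-power index, then so is \<open>M \<inter> N\<close>; hence \<open>pro_p_base G p\<close> together
  with the empty set is closed under binary intersections, and it is a base (not only a subbase) of
  the topology it generates.
\<close>

definition pro_p_topology :: "('a, 'b) monoid_scheme \<Rightarrow> nat \<Rightarrow> 'a topology"
  where "pro_p_topology G p = topology_generated_by (pro_p_base G p)"

lemma (in group) topspace_pro_p_topology: "topspace (pro_p_topology G p) = carrier G"
proof
  have "U \<subseteq> carrier G" if "U \<in> pro_p_base G p" for U
    using that subgroup.rcosets_carrier[OF normal_imp_subgroup is_group]
    unfolding pro_p_base_def by blast
  then show "topspace (pro_p_topology G p) \<subseteq> carrier G"
    unfolding pro_p_topology_def topology_generated_by_topspace by blast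
  have "carrier G #> x = carrier G" if "x \<in> carrier G" for x
    using that coset_join2 subgroup_self by blast
  then have "rcosets (carrier G) = {carrier G}"
    unfolding RCOSETS_def using one_closed by blast
  then have "finite (rcosets (carrier G))" "card (rcosets (carrier G)) = p ^ 0"
      "carrier G \<in> rcosets (carrier G)"
    by simp_all
  then have "carrier G \<in> pro_p_base G p"
    unfolding pro_p_base_def using normal_self by blast
  then show "carrier G \<subseteq> topspace (pro_p_topology G p)"
    unfolding pro_p_topology_def topology_generated_by_topspace by blast
qed

definition closed_under_roots :: "('a, 'b) monoid_scheme \<Rightarrow> 'a set \<Rightarrow> nat \<Rightarrow> bool"
  where "closed_under_roots G H l \<longleftrightarrow> (\<forall>g\<in>carrier G. g [^]\<^bsub>G\<^esub> l \<in> H \<longrightarrow> g \<in> H)"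

text \<open>The set written \<open>L\<^sup>\<bottom>\<close>.\<close>

definition coprime_primes :: "nat set \<Rightarrow> nat set"
  where "coprime_primes L = {p. prime p \<and> (\<forall>l\<in>L. gcd p l = 1)}"

text \<open>
  The coarsest topology containing all pro-\<open>p\<close> topologies for \<open>p \<in> P\<close>; its underlying set is all of
  \<open>carrier G\<close> only if \<open>P\<close> is nonempty.
\<close>

definition joint_pro_p_topology :: "('a, 'b) monoid_scheme \<Rightarrow> nat set \<Rightarrow> 'a topology"
  where "joint_pro_p_topology G P =
    topology_generated_by (\<Union>p\<in>P. {U. openin (pro_p_topology G p) U})"

lemma (in group) topspace_joint_pro_p_topology:
  assumes "P \<noteq> {}"
  shows "topspace (joint_pro_p_topology G P) = carrier G"
proof -
  have "\<Union>{U. openin (pro_p_topology G p) U} = carrier G" for p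
    using topspace_pro_p_topology[of p] by (simp add: topspace_def)
  then have "\<Union>(\<Union>p\<in>P. {U. openin (pro_p_topology G p) U}) = (\<Union>p\<in>P. carrier G)"
    by blast
  then show ?thesis
    using assms by (simp add: joint_pro_p_topology_def)
qed

end

theory Submission
  imports Defs "HOL-Library.Sublist" "HOL-Algebra.Multiplicative_Group"
begin

text \<open>
  Let \<open>C\<close> be generated by \<open>c\<close> and let \<open>g \<notin> C\<close>. If \<open>g\<close> does not commute with \<open>c\<close>, then a
  normal subgroup of \<open>p\<close>-power index that omits the commutator of \<open>g\<close> and \<open>c\<close> separates \<open>g\<close>
  from \<open>C\<close>, for any \<open>p\<close>, because free groups are residually \<open>p\<close>. Otherwise \<open>g = r\<^sup>k\<close> and
  \<open>c = r\<^sup>m\<close> for some \<open>r\<close>, and (unless \<open>c = 1\<close>) a prime power \<open>q\<^sup>a\<close> divides \<open>m\<close> but not \<open>k\<close>.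
  Closure of \<open>C\<close> under roots forces \<open>q \<notin> L\<close>, and a finite \<open>q\<close>-quotient in which the order of
  \<open>r\<close> is divisible by \<open>q\<^sup>a\<close> separates \<open>g\<close> from \<open>C\<close>.

  That free groups are residually \<open>p\<close> is proved by induction on a reduced word: given a finite
  \<open>p\<close>-quotient \<open>Q\<close> in which all suffixes of the tail stay distinct, a homomorphism into the wreath
  product of the cyclic group of order \<open>p\<close> with \<open>Q\<close> keeps all suffixes of the whole word distinct.
\<close>

section \<open>Regular wreath products with a cyclic group\<close>

text \<open>A pair \<open>(f, a)\<close> stands for the map sending \<open>(t, x)\<close> to
  \<open>(t + f x, a x)\<close> on Z/p times \<open>Q\<close>; the product is composition, right
  factor first. Extensional functions with values in \<open>{0..<int p}\<close> make this
  representation unique and the carrier finite.\<close>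

definition wreath :: "nat \<Rightarrow> ('a, 'b) monoid_scheme \<Rightarrow> (('a \<Rightarrow> int) \<times> 'a) monoid"
  where "wreath p Q =
    \<lparr>carrier = (carrier Q \<rightarrow>\<^sub>E {0..<int p}) \<times> carrier Q,
     monoid.mult = (\<lambda>(\<phi>, a) (\<psi>, b). (\<lambda>x\<in>carrier Q. (\<phi> (b \<otimes>\<^bsub>Q\<^esub> x) + \<psi> x) mod int p, a \<otimes>\<^bsub>Q\<^esub> b)),
     monoid.one = (\<lambda>x\<in>carrier Q. 0, \<one>\<^bsub>Q\<^esub>)\<rparr>"

lemma wreath_simps:
  "carrier (wreath p Q) = (carrier Q \<rightarrow>\<^sub>E {0..<int p}) \<times> carrier Q"
  "(\<phi>, a) \<otimes>\<^bsub>wreath p Q\<^esub> (\<psi>, b) =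
    (\<lambda>x\<in>carrier Q. (\<phi> (b \<otimes>\<^bsub>Q\<^esub> x) + \<psi> x) mod int p, a \<otimes>\<^bsub>Q\<^esub> b)"
  "\<one>\<^bsub>wreath p Q\<^esub> = (\<lambda>x\<in>carrier Q. 0, \<one>\<^bsub>Q\<^esub>)"
  by (simp_all add: wreath_def)

lemma finite_wreath: "finite (carrier Q) \<Longrightarrow> finite (carrier (wreath p Q))"
  by (simp add: wreath_simps finite_PiE)

lemma order_wreath: "finite (carrier Q) \<Longrightarrow> order (wreath p Q) = p ^ order Q * order Q"
  by (simp add: order_def wreath_simps card_cartesian_product card_PiE)

lemma PiE_residue:
  "\<phi> \<in> A \<rightarrow>\<^sub>E {0..<int p} \<Longrightarrow> x \<in> A \<Longrightarrow> \<phi> x mod int p = \<phi> x"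
  by (auto dest!: PiE_mem)

context group
begin

lemma wreath_left_inverse:
  assumes "0 < p" "\<phi> \<in> carrier G \<rightarrow>\<^sub>E {0..<int p}" "a \<in> carrier G"
  defines "\<psi> \<equiv> \<lambda>y\<in>carrier G. (- \<phi> (inv a \<otimes> y)) mod int p"
  shows "(\<psi>, inv a) \<in> carrier (wreath p G)"
    and "(\<psi>, inv a) \<otimes>\<^bsub>wreath p G\<^esub> (\<phi>, a) = \<one>\<^bsub>wreath p G\<^esub>"
proof -
  show "(\<psi>, inv a) \<in> carrier (wreath p G)"
    using assms by (simp add: wreath_simps)
  show "(\<psi>, inv a) \<otimes>\<^bsub>wreath p G\<^esub> (\<phi>, a) = \<one>\<^bsub>wreath p G\<^esub>"
    using assms by (auto simp: wreath_simps fun_eq_iff m_assoc[symmetric] mod_simps)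
qed

lemma group_wreath:
  assumes "0 < p"
  shows "group (wreath p G)"
proof (rule groupI)
  fix x y assume "x \<in> carrier (wreath p G)" "y \<in> carrier (wreath p G)"
  then show "x \<otimes>\<^bsub>wreath p G\<^esub> y \<in> carrier (wreath p G)"
    using assms by (cases x; cases y) (simp add: wreath_simps)
next
  show "\<one>\<^bsub>wreath p G\<^esub> \<in> carrier (wreath p G)"
    using assms by (simp add: wreath_simps)
next
  fix x y z
  assume "x \<in> carrier (wreath p G)" "y \<in> carrier (wreath p G)" "z \<in> carrier (wreath p G)"
  then show "x \<otimes>\<^bsub>wreath p G\<^esub> y \<otimes>\<^bsub>wreath p G\<^esub> z = x \<otimes>\<^bsub>wreath p G\<^esub> (y \<otimes>\<^bsub>wreath p G\<^esub> z)"
    by (cases x; cases y; cases z) (auto simp: wreath_simps fun_eq_iff m_assoc mod_simps add.assoc)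
next
  fix x assume "x \<in> carrier (wreath p G)"
  then show "\<one>\<^bsub>wreath p G\<^esub> \<otimes>\<^bsub>wreath p G\<^esub> x = x"
  proof (cases x)
    case (Pair \<phi> a)
    then have \<phi>: "\<phi> \<in> carrier G \<rightarrow>\<^sub>E {0..<int p}" and a: "a \<in> carrier G"
      using \<open>x \<in> carrier (wreath p G)\<close> by (simp_all add: wreath_simps)
    have "(\<lambda>y\<in>carrier G. \<phi> y mod int p) = \<phi>"
      using PiE_residue[OF \<phi>] PiE_arb[OF \<phi>] by (auto simp: fun_eq_iff restrict_def)
    then show ?thesis using Pair a by (simp add: wreath_simps cong: restrict_cong)
  qed
next
  fix x assume x: "x \<in> carrier (wreath p G)"
  obtain \<phi> a where xa: "x = (\<phi>, a)" by (cases x)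
  then have "\<phi> \<in> carrier G \<rightarrow>\<^sub>E {0..<int p}" "a \<in> carrier G"
    using x by (simp_all add: wreath_simps)
  from wreath_left_inverse[OF assms this]
  show "\<exists>y\<in>carrier (wreath p G). y \<otimes>\<^bsub>wreath p G\<^esub> x = \<one>\<^bsub>wreath p G\<^esub>"
    unfolding xa by blast
qed

lemma inv_wreath:
  assumes "0 < p" "\<phi> \<in> carrier G \<rightarrow>\<^sub>E {0..<int p}" "a \<in> carrier G"
  shows "inv\<^bsub>wreath p G\<^esub> (\<phi>, a) = (\<lambda>y\<in>carrier G. (- \<phi> (inv a \<otimes> y)) mod int p, inv a)"
proof -
  interpret W: group "wreath p G" using group_wreath[OF assms(1)] .
  show ?thesis
    using wreath_left_inverse[OF assms] assms W.inv_equality by (simp add: wreath_simps(1))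
qed

text \<open>
  A reduced word moves a point along a path in the Cayley graph. If this path is injective up to the
  last step, the last edge is traversed for the first time, so a cocycle supported on that single
  edge separates the end point from all earlier points.
\<close>

lemma wreath_separates_suffixes:
  assumes p: "1 < p" and g: "g \<in> S \<rightarrow> carrier G"
    and red: "reduced (b # w)" and S: "set (b # w) \<subseteq> S \<times> UNIV"
    and inj: "inj_on (eval_word G g) {u. suffix u w}"
  obtains f where "f \<in> S \<rightarrow> carrier (wreath p G)"
    "inj_on (eval_word (wreath p G) f) {u. suffix u (b # w)}"
proof -
  let ?W = "wreath p G"
  let ?e = "eval_word G g"
  interpret W: group ?W using group_wreath p by simp
  \<comment> \<open>The last edge joins \<open>?e w\<close> and \<open>?e (b # w)\<close>. As edges
    are oriented along generators, its source is the end point \<open>?e (b # w)\<close> when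
    \<open>b\<close> is an inverse letter.\<close>
  define y0 where "y0 = ?e (if snd b then w else b # w)"
  define \<phi> where "\<phi> x = (\<lambda>z\<in>carrier G. if x = fst b \<and> z = y0 then 1 else 0 :: int)" for x
  define f where "f x = (\<phi> x, g x)" for x
  let ?E = "eval_word ?W f"
  have \<phi>: "\<phi> x \<in> carrier G \<rightarrow>\<^sub>E {0..<int p}" for x
    using p by (auto simp: \<phi>_def)
  have f: "f \<in> S \<rightarrow> carrier ?W"
    using \<phi> g by (auto simp: f_def wreath_simps)
  have e_closed: "?e u \<in> carrier G" if "set u \<subseteq> S \<times> UNIV" for u
    using eval_word_closed[OF g that] .
  have e_Cons: "?e (a # u) = eval_letter G g a \<otimes> ?e u" for a u
    by (simp add: eval_word_def)
  have E_closed: "?E u \<in> carrier ?W" if "set u \<subseteq> S \<times> UNIV" for u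
    using W.eval_word_closed[OF f that] .
  have E_Cons: "?E (a # u) = eval_letter ?W f a \<otimes>\<^bsub>?W\<^esub> ?E u" for a u
    by (simp add: eval_word_def)
  \<comment> \<open>The source of the edge traversed by the letter \<open>a\<close> from the point
    \<open>?e u\<close>.\<close>
  define s where "s a u = ?e (if snd a then u else a # u)" for a u
  have letter: "eval_letter ?W f a =
      (if snd a then (\<phi> (fst a), g (fst a))
       else (\<lambda>y\<in>carrier G. (- \<phi> (fst a) (inv (g (fst a)) \<otimes> y)) mod int p, inv (g (fst a))))"
    if "a \<in> S \<times> UNIV" for a
    using that p g \<phi> by (auto simp: eval_letter_def f_def inv_wreath Pi_iff)
  have mult: "fst (y \<otimes>\<^bsub>?W\<^esub> z) = (\<lambda>x\<in>carrier G. (fst y (snd z \<otimes> x) + fst z x) mod int p)"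
    "snd (y \<otimes>\<^bsub>?W\<^esub> z) = snd y \<otimes> snd z" for y z
    by (cases y; cases z; simp add: wreath_simps)+
  have snd_E: "snd (?E u) = ?e u" if "set u \<subseteq> S \<times> UNIV" for u
    using that
  proof (induction u)
    case (Cons a u)
    then show ?case
      using letter[of a] by (simp add: E_Cons e_Cons mult eval_letter_def)
  qed (simp add: eval_word_def wreath_simps)
  \<comment> \<open>Reading \<open>u\<close> from right to left as a path from the identity,
    \<open>c u\<close> counts modulo \<open>p\<close>, with sign, its passages through the marked
    edge.\<close>
  define c where "c u = fst (?E u) \<one>" for u
  have c_Cons: "c (a # u) = ((if fst a = fst b \<and> s a u = y0 then if snd a then 1 else - 1 else 0)
      + c u) mod int p" if "set (a # u) \<subseteq> S \<times> UNIV" for a u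
  proof -
    have a: "a \<in> S \<times> UNIV" and u: "set u \<subseteq> S \<times> UNIV" using that by auto
    have ga: "g (fst a) \<in> carrier G" using a g by auto
    have eu: "snd (?E u) \<otimes> \<one> = ?e u" "?e u \<in> carrier G"
      using snd_E[OF u] e_closed[OF u] by simp_all
    have c: "c (a # u) = (fst (eval_letter ?W f a) (?e u) + c u) mod int p"
      using eu by (simp add: c_def E_Cons mult)
    show ?thesis
    proof (cases "snd a")
      case True
      then show ?thesis using eu(2) unfolding c letter[OF a] by (simp add: \<phi>_def s_def)
    next
      case False
      then have "s a u = inv (g (fst a)) \<otimes> ?e u"
        by (simp add: s_def e_Cons eval_letter_def)
      then show ?thesis
        using False eu(2) ga unfolding c letter[OF a] by (auto simp: \<phi>_def mod_simps)
    qed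
  qed
  have w: "set w \<subseteq> S \<times> UNIV" "b \<in> S \<times> UNIV" using S by auto
  have eb: "eval_letter G g a \<in> carrier G" if "a \<in> S \<times> UNIV" for a
    using eval_letter_closed[OF g that] .
  \<comment> \<open>An earlier passage in the same direction would start at \<open>?e w\<close>, so
    \<open>u = w\<close> by injectivity, against the lengths. One in the opposite direction would
    end at \<open>?e w\<close>, so \<open>w = a # u\<close> with \<open>a = flip b\<close>, and
    \<open>b # w\<close> would not be reduced.\<close>
  have new_edge: "\<not> (fst a = fst b \<and> s a u = y0)" if au: "suffix (a # u) w" for a u
  proof
    assume *: "fst a = fst b \<and> s a u = y0"
    have u: "suffix u w" using suffix_ConsD[OF au] .
    have auS: "set (a # u) \<subseteq> S \<times> UNIV"
      using subset_trans[OF set_mono_suffix[OF au] w(1)] .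
    have neq: "u \<noteq> w" using suffix_length_le[OF au] by auto
    have eu: "?e u \<in> carrier G" "?e w \<in> carrier G" using e_closed auS w(1) by simp_all
    have ew: "?e v = ?e w \<Longrightarrow> v = w" if "suffix v w" for v
      using inj that by (auto simp: inj_on_def)
    show False
    proof (cases "a = b")
      case True
      have "?e u = ?e w"
        using * eu eb[OF w(2)] unfolding True s_def y0_def by (simp add: e_Cons split: if_splits)
      then show False using ew[OF u] neq by simp
    next
      case False
      then have ab: "a = flip b" using * by (auto simp: flip_def prod_eq_iff)
      have il: "eval_letter G g (flip b) = inv (eval_letter G g b)"
        using eval_letter_flip[OF g w(2)] .
      have ea: "?e (a # u) = inv (eval_letter G g b) \<otimes> ?e u"
        using ab il by (simp add: e_Cons)
      have "?e (a # u) = ?e w"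
      proof (cases "snd b")
        case True
        then show ?thesis using * ab by (simp add: s_def y0_def flip_def)
      next
        case False
        then have "?e u = eval_letter G g b \<otimes> ?e w"
          using * ab by (simp add: s_def y0_def e_Cons flip_def)
        then show ?thesis using ea eu eb[OF w(2)] by (simp add: m_assoc[symmetric])
      qed
      then have "a # u = w" using ew[OF au] by simp
      then show False using red ab by (auto simp: reduced_Cons)
    qed
  qed
  have c0: "c u = 0" if "suffix u w" for u
    using that
  proof (induction u)
    case Nil
    show ?case by (simp add: c_def eval_word_def wreath_simps)
  next
    case (Cons a u)
    have "set (a # u) \<subseteq> S \<times> UNIV"
      using subset_trans[OF set_mono_suffix[OF Cons.prems] w(1)] .
    then show ?case
      using c_Cons[of a u] new_edge[OF Cons.prems] Cons.IH suffix_ConsD[OF Cons.prems] by simp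
  qed
  have cb: "c (b # w) \<noteq> 0"
  proof -
    have "s b w = y0" by (simp add: s_def y0_def)
    then have "c (b # w) = (if snd b then 1 else - 1) mod int p"
      using c_Cons[OF S] c0[of w] by simp
    then show ?thesis using p by (simp add: zmod_minus1)
  qed
  \<comment> \<open>The counter tells \<open>b # w\<close> from all suffixes of \<open>w\<close>;
    the latter are already told apart by the second component.\<close>
  have "inj_on ?E {u. suffix u (b # w)}"
  proof (rule inj_onI, clarify)
    fix u v assume uv: "suffix u (b # w)" "suffix v (b # w)" "?E u = ?E v"
    have "c u = c v" using uv(3) by (simp add: c_def)
    moreover have "u = v" if "suffix u w" "suffix v w"
    proof -
      have "set u \<subseteq> S \<times> UNIV" "set v \<subseteq> S \<times> UNIV"
        using subset_trans[OF set_mono_suffix w(1)] that by simp_all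
      then have "?e u = ?e v" using snd_E uv(3) by metis
      then show ?thesis using inj that by (auto simp: inj_on_def)
    qed
    ultimately show "u = v" using uv(1,2) c0 cb by (auto simp: suffix_Cons)
  qed
  then show thesis using that f by blast
qed

end

section \<open>Free groups are residually \<open>p\<close>\<close>

text \<open>These are exactly the subgroups whose cosets make up
  \<open>pro_p_base G p\<close>.\<close>

definition p_power_index :: "('a, 'b) monoid_scheme \<Rightarrow> nat \<Rightarrow> 'a set \<Rightarrow> bool"
  where "p_power_index G p N \<longleftrightarrow>
    N \<lhd> G \<and> finite (rcosets\<^bsub>G\<^esub> N) \<and> (\<exists>k. card (rcosets\<^bsub>G\<^esub> N) = p ^ k)"

text \<open>The bijection of the first isomorphism theorem, used to compute the index of a kernel as
  the size of the image.\<close>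

lemma (in group_hom) rcosets_kernel_bij_betw_image:
  "bij_betw (\<lambda>X. the_elem (h ` X)) (rcosets (kernel G H h)) (h ` carrier G)"
proof -
  have "h ` (kernel G H h #> x) = {h x}" if "x \<in> carrier G" for x
    using that by (force simp: r_coset_def kernel_def)
  then have "(\<lambda>X. the_elem (h ` X)) ` (rcosets (kernel G H h)) = h ` carrier G"
    by (simp add: RCOSETS_def UNION_singleton_eq_range image_image)
  then show ?thesis
    using FactGroup_inj_on by (simp add: bij_betw_def FactGroup_def)
qed

text \<open>The index is the order of the image, which divides \<open>p ^ k\<close> by
  Lagrange.\<close>

lemma (in group_hom) p_power_index_kernel:
  assumes p: "prime p" and fin: "finite (carrier H)" and ord: "order H = p ^ k"
  shows "p_power_index G p (kernel G H h)"
proof -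
  have "card (h ` carrier G) dvd p ^ k"
    using H.lagrange[OF img_is_subgroup] ord by (metis dvd_triv_right)
  then have "\<exists>j. card (h ` carrier G) = p ^ j"
    using divides_primepow_nat[OF p] by blast
  moreover have "finite (h ` carrier G)"
    using fin by (rule finite_subset[rotated]) auto
  ultimately show ?thesis
    using normal_kernel rcosets_kernel_bij_betw_image
    unfolding p_power_index_def by (metis bij_betw_finite bij_betw_same_card)
qed

lemma (in group) p_power_index_carrier: "p_power_index G p (carrier G)"
proof -
  have "carrier G #> x = carrier G" if "x \<in> carrier G" for x
    using that coset_join2 subgroup_self by blast
  then have "rcosets (carrier G) = {carrier G}"
    unfolding RCOSETS_def using one_closed by blast
  then show ?thesis
    unfolding p_power_index_def using normal_self by (auto intro: exI[of _ 0])
qed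

text \<open>The number \<open>p ^ b\<close> is the order of the coset of \<open>x\<close> in
  \<open>G Mod N\<close>, a divisor of the order of that quotient.\<close>

lemma (in group) p_power_index_pow_mem:
  assumes p: "prime p" and N: "p_power_index G p N" and x: "x \<in> carrier G"
  obtains b where "\<And>e :: int. x [^] e \<in> N \<longleftrightarrow> int (p ^ b) dvd e"
proof -
  interpret N: normal N G using N by (simp add: p_power_index_def)
  interpret Q: group "G Mod N" by (rule N.factorgroup_is_group)
  have Nx: "N #> x \<in> carrier (G Mod N)"
    using x by (auto simp: FactGroup_def RCOSETS_def)
  obtain k where "order (G Mod N) = p ^ k"
    using N by (auto simp: p_power_index_def order_def FactGroup_def)
  then obtain b where b: "Q.ord (N #> x) = p ^ b"
    using Q.ord_dvd_group_order[OF Nx] divides_primepow_nat[OF p] by auto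
  have "x [^] e \<in> N \<longleftrightarrow> int (p ^ b) dvd e" for e :: int
  proof -
    have "x [^] e \<in> N \<longleftrightarrow> N #> (x [^] e) = N"
      using coset_join1[OF _ _ N.subgroup_axioms] coset_join2[OF _ N.subgroup_axioms] int_pow_closed[OF x]
      by metis
    also have "\<dots> \<longleftrightarrow> (N #> x) [^]\<^bsub>G Mod N\<^esub> e = \<one>\<^bsub>G Mod N\<^esub>"
      using x by (simp add: N.FactGroup_int_pow)
    finally show ?thesis
      using Q.int_pow_eq_id[OF Nx] b by simp
  qed
  then show thesis using that by blast
qed

lemma free_group_Cons:
  assumes "a # w \<in> carrier (free_group S)"
  shows "[a] \<in> carrier (free_group S)" "w \<in> carrier (free_group S)"
    "a # w = [a] \<otimes>\<^bsub>free_group S\<^esub> w"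
  using assms by (auto simp: free_group_def reduced_Cons push_def)

text \<open>Separating all suffixes, rather than just \<open>w\<close> from the empty word, is what
  makes the induction work: the wreath product step needs the path of the tail to be
  injective.\<close>

lemma free_group_separates_suffixes:
  assumes p: "prime p" and "w \<in> carrier (free_group S)"
  shows "\<exists>N. p_power_index (free_group S) p N \<and>
    inj_on (\<lambda>u. N #>\<^bsub>free_group S\<^esub> u) {u. suffix u w}"
  using assms(2)
proof (induction w)
  case Nil
  interpret F: group "free_group S" by (rule group_free_group)
  show ?case using F.p_power_index_carrier by auto
next
  case (Cons b w)
  let ?F = "free_group S"
  interpret F: group ?F by (rule group_free_group)
  obtain N where N: "p_power_index ?F p N"
    and inj: "inj_on (\<lambda>u. N #>\<^bsub>?F\<^esub> u) {u. suffix u w}"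
    using Cons free_group_Cons(2) by blast
  interpret N: normal N ?F using N by (simp add: p_power_index_def)
  let ?Q = "?F Mod N"
  interpret Q: group ?Q by (rule N.factorgroup_is_group)
  define g where "g x = N #>\<^bsub>?F\<^esub> [(x, True)]" for x
  have g: "g \<in> S \<rightarrow> carrier ?Q"
  proof
    fix x assume "x \<in> S"
    then have "[(x, True)] \<in> carrier ?F" by (simp add: free_group_def reduced_Cons)
    then show "g x \<in> carrier ?Q" by (auto simp: g_def FactGroup_def RCOSETS_def)
  qed
  \<comment> \<open>By uniqueness in the universal property the quotient map is an evaluation, so
    the induction hypothesis takes the form required by
    \<open>wreath_separates_suffixes\<close>.\<close>
  have ev: "N #>\<^bsub>?F\<^esub> u = eval_word ?Q g u" if "u \<in> carrier ?F" for u
    using Q.free_group_universal(3)[OF g N.r_coset_hom_Mod _ that] by (simp add: g_def)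
  have sub: "u \<in> carrier ?F" if "suffix u v" "v \<in> carrier ?F" for u v
    using that by (auto simp: suffix_def free_group_def reduced_def successively_append_iff)
  have w: "w \<in> carrier ?F" using free_group_Cons(2) Cons.prems .
  have injQ: "inj_on (eval_word ?Q g) {u. suffix u w}"
    using inj ev sub[OF _ w] by (simp add: inj_on_def)
  have p1: "1 < p" using p prime_gt_1_nat by blast
  have red: "reduced (b # w)" "set (b # w) \<subseteq> S \<times> UNIV"
    using Cons.prems by (auto simp: free_group_def)
  let ?W = "wreath p ?Q"
  obtain f where f: "f \<in> S \<rightarrow> carrier ?W"
    and injW: "inj_on (eval_word ?W f) {u. suffix u (b # w)}"
    using Q.wreath_separates_suffixes[OF p1 g red injQ] .
  interpret W: group ?W using Q.group_wreath p1 by simp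
  interpret h: group_hom ?F ?W "eval_word ?W f"
    using W.free_group_universal(1)[OF f] by unfold_locales
  have finQ: "finite (carrier ?Q)" and "\<exists>k. order ?Q = p ^ k"
    using N by (auto simp: p_power_index_def order_def FactGroup_def)
  then obtain k where "order ?Q = p ^ k" by blast
  then have "order ?W = p ^ (order ?Q + k)"
    using order_wreath[OF finQ] by (simp add: power_add)
  then have K: "p_power_index ?F p (kernel ?F ?W (eval_word ?W f))" (is "p_power_index _ _ ?K")
    using h.p_power_index_kernel[OF p] finite_wreath[OF finQ] by blast
  have "eval_word ?W f u = eval_word ?W f v"
    if uv: "u \<in> carrier ?F" "v \<in> carrier ?F" "?K #>\<^bsub>?F\<^esub> u = ?K #>\<^bsub>?F\<^esub> v" for u v
  proof -
    have "v \<in> ?K #>\<^bsub>?F\<^esub> u"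
      using F.rcos_self[OF uv(2) h.subgroup_kernel] uv(3) by simp
    then show ?thesis using uv(1) by (auto simp: r_coset_def kernel_def)
  qed
  then have "inj_on (\<lambda>u. ?K #>\<^bsub>?F\<^esub> u) {u. suffix u (b # w)}"
    using injW sub[OF _ Cons.prems] by (simp add: inj_on_def)
  then show ?case using K by blast
qed

text \<open>Both \<open>w\<close> and the empty word, which is the identity, are suffixes of
  \<open>w\<close>, so their cosets differ.\<close>

theorem free_group_residually_p:
  assumes p: "prime p" and w: "w \<in> carrier (free_group S)" "w \<noteq> \<one>\<^bsub>free_group S\<^esub>"
  obtains N where "p_power_index (free_group S) p N" "w \<notin> N"
proof -
  interpret F: group "free_group S" by (rule group_free_group)
  obtain N where N: "p_power_index (free_group S) p N"
    and inj: "inj_on (\<lambda>u. N #>\<^bsub>free_group S\<^esub> u) {u. suffix u w}"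
    using free_group_separates_suffixes[OF p w(1)] by blast
  interpret N: normal N "free_group S" using N by (simp add: p_power_index_def)
  have "w \<notin> N"
  proof
    assume "w \<in> N"
    then have "N #>\<^bsub>free_group S\<^esub> w = N #>\<^bsub>free_group S\<^esub> \<one>\<^bsub>free_group S\<^esub>"
      using F.coset_join2[OF w(1) N.subgroup_axioms] N.subset by simp
    then show False
      using w inj by (auto simp: inj_on_def free_group_def)
  qed
  then show thesis using N that by blast
qed

text \<open>For a prime \<open>p\<close> above the absolute value of \<open>e\<close>, some finite
  \<open>p\<close>-quotient keeps \<open>x\<close> nontrivial. The order of \<open>x\<close> there
  is a multiple of \<open>p\<close> and divides \<open>e\<close>, which is impossible unless
  \<open>e = 0\<close>.\<close>

lemma free_group_torsion_free:
  fixes e :: int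
  assumes x: "x \<in> carrier (free_group S)" "x \<noteq> \<one>\<^bsub>free_group S\<^esub>"
    and e: "x [^]\<^bsub>free_group S\<^esub> e = \<one>\<^bsub>free_group S\<^esub>"
  shows "e = 0"
proof (rule ccontr)
  assume "e \<noteq> 0"
  interpret F: group "free_group S" by (rule group_free_group)
  obtain p where p: "prime p" "nat \<bar>e\<bar> < p" using bigger_prime by blast
  obtain N where N: "p_power_index (free_group S) p N" "x \<notin> N"
    using free_group_residually_p[OF p(1) x] .
  obtain b where b: "\<And>e :: int. x [^]\<^bsub>free_group S\<^esub> e \<in> N \<longleftrightarrow> int (p ^ b) dvd e"
    by (rule F.p_power_index_pow_mem[OF p(1) N(1) x(1)]) blast
  have "b \<noteq> 0" using b[of 1] N(2) x(1) by (cases b) auto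
  have "\<one>\<^bsub>free_group S\<^esub> \<in> N"
    using N(1) by (auto simp: p_power_index_def intro: subgroup.one_closed normal_imp_subgroup)
  then have "int (p ^ b) dvd e" using b[of e] e by simp
  moreover have "int p dvd int (p ^ b)" using \<open>b \<noteq> 0\<close> by (simp add: dvd_power)
  ultimately have "int p dvd e" by (rule dvd_trans[rotated])
  then show False using p(2) \<open>e \<noteq> 0\<close> dvd_imp_le_int[of e "int p"] by auto
qed

text \<open>By torsion-freeness the power of \<open>x\<close> with exponent \<open>p ^ a\<close> is
  nontrivial. In a \<open>p\<close>-quotient where it survives, the order of \<open>x\<close> is a
  power of \<open>p\<close> not dividing \<open>p ^ a\<close>, hence a multiple of
  \<open>p ^ a\<close>.\<close>

lemma free_group_residual_order:
  assumes p: "prime p" and x: "x \<in> carrier (free_group S)" "x \<noteq> \<one>\<^bsub>free_group S\<^esub>"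
  obtains N where "p_power_index (free_group S) p N"
    "\<And>e :: int. x [^]\<^bsub>free_group S\<^esub> e \<in> N \<Longrightarrow> int (p ^ a) dvd e"
proof -
  interpret F: group "free_group S" by (rule group_free_group)
  let ?y = "x [^]\<^bsub>free_group S\<^esub> int (p ^ a)"
  have "p \<noteq> 0" using p by auto
  then have "?y \<noteq> \<one>\<^bsub>free_group S\<^esub>"
    using free_group_torsion_free[OF x, of "int (p ^ a)"] by auto
  then obtain N where N: "p_power_index (free_group S) p N" "?y \<notin> N"
    using free_group_residually_p[OF p, of ?y] x(1) by blast
  obtain b where b: "\<And>e :: int. x [^]\<^bsub>free_group S\<^esub> e \<in> N \<longleftrightarrow> int (p ^ b) dvd e"
    by (rule F.p_power_index_pow_mem[OF p N(1) x(1)]) blast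
  have "a \<le> b"
    using b[of "int (p ^ a)"] N(2) by (metis int_dvd_int_iff le_imp_power_dvd nle_le)
  then have "int (p ^ a) dvd int (p ^ b)" by (simp add: le_imp_power_dvd)
  then show thesis using that N(1) b dvd_trans by blast
qed

section \<open>Commuting elements of free groups\<close>

text \<open>Here \<open>z\<close> is an arbitrary word: word combinatorics yields a common root of
  two words, and this turns its repetitions into powers of the normal form \<open>r\<close>.\<close>

lemma foldr_push_concat_replicate:
  fixes z defines "r \<equiv> foldr push z []"
  assumes "r \<in> carrier (free_group S)"
  shows "foldr push (concat (replicate m z)) [] = r [^]\<^bsub>free_group S\<^esub> m"
proof -
  interpret F: group "free_group S" by (rule group_free_group)
  have z: "foldr push z v = foldr push r v" if "reduced v" for v
    using foldr_push_assoc[of "[]" v z] that by (simp add: r_def)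
  show ?thesis
  proof (induction m)
    case 0
    then show ?case by (simp add: free_group_def)
  next
    case (Suc m)
    have "foldr push (concat (replicate (Suc m) z)) [] = foldr push r (foldr push (concat (replicate m z)) [])"
      by (simp add: z reduced_foldr_push)
    also have "\<dots> = r \<otimes>\<^bsub>free_group S\<^esub> r [^]\<^bsub>free_group S\<^esub> m"
      unfolding Suc by (simp add: free_group_def)
    also have "\<dots> = r [^]\<^bsub>free_group S\<^esub> Suc m"
      using F.nat_pow_Suc2 assms(2) by simp
    finally show ?case .
  qed
qed

lemma foldr_push_append:
  assumes "reduced (u @ v)"
  shows "foldr push u v = u @ v"
proof -
  have "reduced v" using assms by (simp add: reduced_def successively_append_iff)
  then show ?thesis
    using foldr_push_reduced[OF assms] by (simp add: foldr_push_reduced)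
qed

text \<open>A junction that is not reduced loses a pair of letters, and \<open>push\<close> adds at
  most one letter. Thus the length of a product detects cancellation.\<close>

lemma length_foldr_push_less:
  assumes "reduced u" "reduced v" "\<not> reduced (u @ v)"
  shows "length (foldr push u v) < length u + length v"
proof -
  have len: "length (foldr push s t) \<le> length s + length t" for s t :: "'a letter list"
  proof (induction s)
    case (Cons a s)
    then show ?case by (auto simp: push_def)
  qed simp
  have "u \<noteq> []" "v \<noteq> []" "hd v = flip (last u)"
    using assms by (auto simp: reduced_def successively_append_iff)
  then have "u = butlast u @ [last u]" "v = flip (last u) # tl v"
    by (simp_all add: hd_Cons_tl[symmetric] del: hd_Cons_tl) (metis list.collapse)
  then obtain a u' v' where uv: "u = u' @ [a]" "v = flip a # v'" by blast
  then show ?thesis using len[of u' v'] by (simp add: push_def)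
qed

text \<open>The product has full length because \<open>g @ c\<close> is reduced. It is also the
  product in the other order, so \<open>c @ g\<close> is reduced too and
  \<open>g @ c = c @ g\<close> as words; commuting words are repetitions of a common word.\<close>

lemma commuting_cyclically_reduced:
  assumes c: "c \<in> carrier (free_group S)" "c \<noteq> []" and g: "g \<in> carrier (free_group S)"
    and comm: "g \<otimes>\<^bsub>free_group S\<^esub> c = c \<otimes>\<^bsub>free_group S\<^esub> g" and gc: "reduced (g @ c)"
  obtains r k m where "r \<in> carrier (free_group S)"
    "g = r [^]\<^bsub>free_group S\<^esub> (k :: nat)" "c = r [^]\<^bsub>free_group S\<^esub> (m :: nat)"
proof -
  have red: "reduced g" "reduced c" using g c by (auto simp: free_group_def)
  have eq: "foldr push c g = g @ c"
    using comm foldr_push_append[OF gc] by (simp add: free_group_def)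
  then have "reduced (c @ g)"
    using length_foldr_push_less[of c g] red by fastforce
  then have "g @ c = c @ g" using eq foldr_push_append by metis
  then obtain k m z where z: "concat (replicate k z) = g" "concat (replicate m z) = c"
    using comm_append_are_replicate by blast
  \<comment> \<open>As \<open>c\<close> is nonempty, \<open>m\<close> is positive; for
    \<open>m = 0\<close> the letters of \<open>z\<close> would be unconstrained.\<close>
  have "set z \<subseteq> set c" using z(2) c(2) by (cases m) auto
  then have "set z \<subseteq> S \<times> UNIV" using c(1) by (auto simp: free_group_def)
  then have r: "foldr push z [] \<in> carrier (free_group S)"
    using set_foldr_push[of z "[]"] by (auto simp: free_group_def reduced_foldr_push)
  show thesis
    using that[OF r] foldr_push_concat_replicate[OF r] z red foldr_push_reduced by metis
qed

lemma (in group) int_pow_conjugate: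
  assumes "a \<in> carrier G" "x \<in> carrier G"
  shows "(a \<otimes> x \<otimes> inv a) [^] (k :: int) = a \<otimes> x [^] k \<otimes> inv a"
proof -
  have "(\<lambda>x. a \<otimes> x \<otimes> inv a) \<in> hom G G"
    using assms(1) by (auto simp: hom_def m_assoc inv_solve_left)
  from hom_int_pow[OF this assms(2) is_group is_group] show ?thesis by simp
qed

lemma inv_free_group:
  assumes "w \<in> carrier (free_group S)"
  shows "inv\<^bsub>free_group S\<^esub> w = rev (map flip w)"
proof -
  interpret F: group "free_group S" by (rule group_free_group)
  have "rev (map flip w) \<in> carrier (free_group S)"
    using assms by (auto simp: free_group_def reduced_def successively_map flip_def prod_eq_iff
        elim!: successively_mono)
  moreover have "rev (map flip w) \<otimes>\<^bsub>free_group S\<^esub> w = \<one>\<^bsub>free_group S\<^esub>"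
    using assms foldr_push_inverse[of "[]" w] by (simp add: free_group_def foldr_push_reduced)
  ultimately show ?thesis using assms F.inv_equality by blast
qed

text \<open>If \<open>c\<close> starts and ends with mutually inverse letters, conjugation by that
  letter shortens it and the induction applies. Otherwise \<open>c\<close> is cyclically reduced,
  and \<open>g\<close> or its inverse can be put next to \<open>c\<close> without cancellation,
  which reduces the claim to words.\<close>

theorem free_group_commuting:
  assumes "c \<in> carrier (free_group S)" "c \<noteq> \<one>\<^bsub>free_group S\<^esub>" "g \<in> carrier (free_group S)"
    and "g \<otimes>\<^bsub>free_group S\<^esub> c = c \<otimes>\<^bsub>free_group S\<^esub> g"
  shows "\<exists>r \<in> carrier (free_group S). \<exists>(k :: int) (m :: int).
    g = r [^]\<^bsub>free_group S\<^esub> k \<and> c = r [^]\<^bsub>free_group S\<^esub> m"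
  using assms
proof (induction c arbitrary: g rule: length_induct)
  case (1 c)
  let ?F = "free_group S"
  interpret F: group ?F by (rule group_free_group)
  note c = 1(2) and g = 1(4) and comm = 1(5)
  have c0: "c \<noteq> []" using 1(3) by (simp add: free_group_def)
  have red: "reduced c" "reduced g" using c g by (auto simp: free_group_def)
  show ?case
  proof (cases "hd c = flip (last c)")
    case True
    define a where "a = hd c"
    define d where "d = butlast (tl c)"
    have "tl c \<noteq> []"
    proof
      assume "tl c = []"
      then have "c = [hd c]" using c0 by (metis list.collapse)
      then show False using True by (metis flip_neq(1) last.simps)
    qed
    then have cd: "c = a # d @ [flip a]"
      using c0 True by (metis a_def d_def append_butlast_last_id flip_flip last_tl list.collapse)
    have a: "[a] \<in> carrier ?F" and d: "d \<in> carrier ?F" and fa: "[flip a] \<in> carrier ?F"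
      using c unfolding cd
      by (auto simp: free_group_def reduced_def successively_Cons successively_append_iff)
    have inva: "[flip a] = inv\<^bsub>?F\<^esub> [a]" using inv_free_group[OF a] by simp
    have da: "foldr push d [flip a] = d @ [flip a]"
      using red(1) unfolding cd by (intro foldr_push_append) (simp add: reduced_Cons)
    have c_conj: "c = [a] \<otimes>\<^bsub>?F\<^esub> d \<otimes>\<^bsub>?F\<^esub> inv\<^bsub>?F\<^esub> [a]"
    proof -
      have "c = [a] \<otimes>\<^bsub>?F\<^esub> (d @ [flip a])"
        using free_group_Cons(3)[of a "d @ [flip a]" S] c cd by simp
      also have "d @ [flip a] = d \<otimes>\<^bsub>?F\<^esub> [flip a]"
        using da by (simp add: free_group_def)
      finally show ?thesis using a d fa inva by (simp add: F.m_assoc)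
    qed
    \<comment> \<open>The conjugation taking \<open>c\<close> to \<open>d\<close> takes
      \<open>g\<close> to \<open>g'\<close>, so these commute as well; a common root of
      \<open>g'\<close> and \<open>d\<close> is then conjugated back.\<close>
    define g' where "g' = inv\<^bsub>?F\<^esub> [a] \<otimes>\<^bsub>?F\<^esub> g \<otimes>\<^bsub>?F\<^esub> [a]"
    have g': "g' \<in> carrier ?F" using a g by (simp add: g'_def)
    have g_conj: "g = [a] \<otimes>\<^bsub>?F\<^esub> g' \<otimes>\<^bsub>?F\<^esub> inv\<^bsub>?F\<^esub> [a]"
      using a g by (simp add: g'_def F.m_assoc) (simp add: F.m_assoc[symmetric])
    have conj_mult: "([a] \<otimes>\<^bsub>?F\<^esub> x \<otimes>\<^bsub>?F\<^esub> inv\<^bsub>?F\<^esub> [a]) \<otimes>\<^bsub>?F\<^esub> ([a] \<otimes>\<^bsub>?F\<^esub> y \<otimes>\<^bsub>?F\<^esub> inv\<^bsub>?F\<^esub> [a])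
        = [a] \<otimes>\<^bsub>?F\<^esub> (x \<otimes>\<^bsub>?F\<^esub> y) \<otimes>\<^bsub>?F\<^esub> inv\<^bsub>?F\<^esub> [a]"
      if "x \<in> carrier ?F" "y \<in> carrier ?F" for x y
      using that a F.m_assoc[of "inv\<^bsub>?F\<^esub> [a]" "[a]", symmetric] by (simp add: F.m_assoc)
    have "g' \<otimes>\<^bsub>?F\<^esub> d = d \<otimes>\<^bsub>?F\<^esub> g'"
      using comm conj_mult[OF g' d] conj_mult[OF d g'] a d g' by (simp flip: c_conj g_conj)
    moreover have "d \<noteq> \<one>\<^bsub>?F\<^esub>"
      using c_conj 1(3) a by auto
    moreover have "length d < length c" using cd by simp
    ultimately have "\<exists>r \<in> carrier ?F. \<exists>(k :: int) (m :: int).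
        g' = r [^]\<^bsub>?F\<^esub> k \<and> d = r [^]\<^bsub>?F\<^esub> m"
      using 1(1)[rule_format, OF _ d _ g'] by simp
    then obtain r k m where r: "r \<in> carrier ?F"
      "g' = r [^]\<^bsub>?F\<^esub> (k :: int)" "d = r [^]\<^bsub>?F\<^esub> (m :: int)"
      by blast
    then have "g = ([a] \<otimes>\<^bsub>?F\<^esub> r \<otimes>\<^bsub>?F\<^esub> inv\<^bsub>?F\<^esub> [a]) [^]\<^bsub>?F\<^esub> k"
      "c = ([a] \<otimes>\<^bsub>?F\<^esub> r \<otimes>\<^bsub>?F\<^esub> inv\<^bsub>?F\<^esub> [a]) [^]\<^bsub>?F\<^esub> m"
      using g_conj c_conj F.int_pow_conjugate[OF a r(1)] by simp_all
    moreover have "[a] \<otimes>\<^bsub>?F\<^esub> r \<otimes>\<^bsub>?F\<^esub> inv\<^bsub>?F\<^esub> [a] \<in> carrier ?F" using a r by simp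
    ultimately show ?thesis by blast
  next
    case False
    show ?thesis
    proof (cases "reduced (g @ c)")
      case True
      obtain r k m where r: "r \<in> carrier ?F"
          "g = r [^]\<^bsub>?F\<^esub> (k :: nat)" "c = r [^]\<^bsub>?F\<^esub> (m :: nat)"
        using commuting_cyclically_reduced[OF c c0 g comm True] .
      then have "g = r [^]\<^bsub>?F\<^esub> int k" "c = r [^]\<^bsub>?F\<^esub> int m" by (simp_all add: int_pow_int)
      then show ?thesis using r(1) by blast
    next
      case gc: False
      text \<open>If both products \<open>g @ c\<close> and \<open>c @ g\<close> cancel, then \<open>inv g @ c\<close> does not.\<close>
      let ?h = "inv\<^bsub>?F\<^esub> g"
      have h: "?h \<in> carrier ?F" using g by simp
      have "length (foldr push c g) < length c + length g"
        using length_foldr_push_less[OF red(2,1) gc] comm by (simp add: free_group_def)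
      then have "\<not> reduced (c @ g)" using foldr_push_append[of c g] by auto
      then have "g \<noteq> []" "hd g = flip (last c)"
        using red by (auto simp: reduced_def successively_append_iff)
      \<comment> \<open>Since \<open>?h\<close> ends in the same letter as \<open>c\<close>, it
        could cancel against \<open>c\<close> only if \<open>c\<close> cancelled against itself,
        which the case assumption on \<open>hd c\<close> excludes.\<close>
      then have "last ?h = last c" "?h \<noteq> []"
        using inv_free_group[OF g] by (simp_all add: last_rev hd_map)
      moreover have "reduced ?h" using h by (simp add: free_group_def)
      ultimately have hc: "reduced (?h @ c)"
        using red(1) False by (simp add: reduced_def successively_append_iff)
      have "?h \<otimes>\<^bsub>?F\<^esub> c = c \<otimes>\<^bsub>?F\<^esub> ?h"
        using comm c g by (metis F.inv_solve_left F.inv_solve_right F.m_assoc F.m_closed h)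
      then obtain r k m where r: "r \<in> carrier ?F"
          "?h = r [^]\<^bsub>?F\<^esub> (k :: nat)" "c = r [^]\<^bsub>?F\<^esub> (m :: nat)"
        using commuting_cyclically_reduced[OF c c0 h _ hc] by blast
      then have "g = r [^]\<^bsub>?F\<^esub> (- int k)" "c = r [^]\<^bsub>?F\<^esub> int m"
        using F.inv_inv[OF g] by (simp_all add: int_pow_int F.int_pow_neg)
      then show ?thesis using r(1) by blast
    qed
  qed
qed

section \<open>Separating elements from cyclic subgroups\<close>

text \<open>Taking for \<open>p ^ a\<close> the full power of \<open>p\<close> in \<open>m\<close>
  compares multiplicities at every prime. The contrapositive supplies a prime power dividing
  \<open>m\<close> but not \<open>k\<close>.\<close>

lemma int_dvd_primepowI:
  fixes k m :: int
  assumes "m \<noteq> 0" "\<And>p a. prime p \<Longrightarrow> int (p ^ a) dvd m \<Longrightarrow> int (p ^ a) dvd k"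
  shows "m dvd k"
proof -
  have "multiplicity p (nat \<bar>m\<bar>) \<le> multiplicity p (nat \<bar>k\<bar>)"
    if "prime p" "k \<noteq> 0" for p
  proof -
    have "p ^ multiplicity p (nat \<bar>m\<bar>) dvd nat \<bar>m\<bar>" by (rule multiplicity_dvd)
    then have "int (p ^ multiplicity p (nat \<bar>m\<bar>)) dvd k"
      using assms(2)[OF that(1)] by (metis int_dvd_int_iff dvd_abs_iff nat_0_le abs_ge_zero)
    then have "p ^ multiplicity p (nat \<bar>m\<bar>) dvd nat \<bar>k\<bar>"
      by (metis int_dvd_int_iff dvd_abs_iff nat_0_le abs_ge_zero)
    then show ?thesis using that by (intro multiplicity_geI) auto
  qed
  then have "nat \<bar>m\<bar> dvd nat \<bar>k\<bar>" if "k \<noteq> 0"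
    using assms(1) that by (intro multiplicity_le_imp_dvd) auto
  then show ?thesis by (cases "k = 0") (auto simp: nat_abs_dvd_iff)
qed

text \<open>The coset of \<open>N\<close> through \<open>g\<close> is an open neighbourhood of
  \<open>g\<close>, and it contains \<open>c\<close> only if the quotient of \<open>c\<close> by
  \<open>g\<close> lies in \<open>N\<close>. So every point outside \<open>C\<close> is interior to
  the complement.\<close>

lemma (in group) closedin_joint_pro_p_topology:
  assumes "P \<noteq> {}" "C \<subseteq> carrier G"
    and sep: "\<And>g. g \<in> carrier G \<Longrightarrow> g \<notin> C \<Longrightarrow>
      \<exists>p\<in>P. \<exists>N. p_power_index G p N \<and> (\<forall>c\<in>C. c \<otimes> inv g \<notin> N)"
  shows "closedin (joint_pro_p_topology G P) C"
proof -
  have "\<exists>U. openin (joint_pro_p_topology G P) U \<and> g \<in> U \<and> U \<subseteq> carrier G - C"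
    if g: "g \<in> carrier G" "g \<notin> C" for g
  proof -
    obtain p N where p: "p \<in> P" and N: "p_power_index G p N" and C: "\<forall>c\<in>C. c \<otimes> inv g \<notin> N"
      using sep[OF g] by blast
    interpret N: normal N G using N by (simp add: p_power_index_def)
    have "N #> g \<in> rcosets N" using g by (auto simp: RCOSETS_def)
    then have "N #> g \<in> pro_p_base G p"
      using N by (auto simp: p_power_index_def pro_p_base_def)
    then have "openin (pro_p_topology G p) (N #> g)"
      unfolding pro_p_topology_def by (rule topology_generated_by_Basis)
    then have "openin (joint_pro_p_topology G P) (N #> g)"
      unfolding joint_pro_p_topology_def using p by (intro topology_generated_by_Basis) blast
    moreover have "g \<in> N #> g" using rcos_self[OF g(1) N.subgroup_axioms] .
    moreover have "N #> g \<subseteq> carrier G" using r_coset_subset_G N.subset g by blast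
    moreover have "c \<notin> N #> g" if "c \<in> C" for c
      using that C g assms(2) N.rcos_module[OF is_group] by blast
    ultimately show ?thesis by blast
  qed
  then have "openin (joint_pro_p_topology G P) (carrier G - C)"
    by (subst openin_subopen) blast
  then show ?thesis
    using assms(1,2) by (simp add: closedin_def topspace_joint_pro_p_topology)
qed

text \<open>Modulo \<open>N\<close> the elements \<open>h\<close> and \<open>g\<close> agree, so
  \<open>g\<close> commutes with \<open>c\<close> there. Conversely, an \<open>N\<close> omitting
  the commutator separates \<open>g\<close> from the whole centralizer of \<open>c\<close>.\<close>

lemma (in group) commutator_separates:
  assumes N: "p_power_index G p N" and g: "g \<in> carrier G" and c: "c \<in> carrier G"
    and h: "h \<in> carrier G" "h \<otimes> c = c \<otimes> h" and hg: "h \<otimes> inv g \<in> N"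
  shows "(g \<otimes> c) \<otimes> inv (c \<otimes> g) \<in> N"
proof -
  interpret N: normal N G using N by (simp add: p_power_index_def)
  have "N #> h = N #> g"
    using coset_join2[OF _ N.subgroup_axioms hg] coset_mult_inv1 g h(1) N.subset by simp
  then have "N #> (g \<otimes> c) = N #> (c \<otimes> g)"
    using N.rcos_sum g c h by metis
  then have "N #> ((g \<otimes> c) \<otimes> inv (c \<otimes> g)) = N"
    using coset_mult_inv2 g c N.subset by simp
  then show ?thesis using coset_join1[OF _ _ N.subgroup_axioms] g c by simp
qed

theorem theorem1p5:
  fixes n :: nat and C :: "nat letter list set" and L :: "nat set"
  assumes "subgroup C (free_group_of_rank n)"
    and "cyclic_group ((free_group_of_rank n)\<lparr>carrier := C\<rparr>)"
    and "\<forall>l\<in>L. prime l"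
    and "coprime_primes L \<noteq> {}"
    and "\<forall>l\<in>L. closed_under_roots (free_group_of_rank n) C l"
  shows "closedin (joint_pro_p_topology (free_group_of_rank n) (coprime_primes L)) C"
proof -
  define F where "F = free_group_of_rank n"
  interpret F: group F unfolding F_def by (rule group_free_group)
  interpret C: subgroup C F using assms(1) by (simp add: F_def)
  interpret FC: group "F\<lparr>carrier := C\<rparr>" by (rule C.subgroup_is_group) (rule F.is_group)
  obtain c where c: "c \<in> C" and C: "C = range (\<lambda>i :: int. c [^]\<^bsub>F\<^esub> i)"
  proof -
    obtain c where c: "c \<in> C" "C = range (\<lambda>i :: int. c [^]\<^bsub>F\<lparr>carrier := C\<rparr>\<^esub> i)"
      using assms(2) FC.cyclic_group unfolding F_def[symmetric] by auto
    then have "C = range (\<lambda>i :: int. c [^]\<^bsub>F\<^esub> i)"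
      using F.int_pow_consistent[OF C.subgroup_axioms c(1)] by simp
    then show thesis using that c(1) by blast
  qed
  have cF: "c \<in> carrier F" using c by (rule C.mem_carrier)
  obtain p0 where p0: "p0 \<in> coprime_primes L" "prime p0"
    using assms(4) by (auto simp: coprime_primes_def)
  have "closedin (joint_pro_p_topology F (coprime_primes L)) C"
  proof (rule F.closedin_joint_pro_p_topology)
    show "coprime_primes L \<noteq> {}" "C \<subseteq> carrier F" using assms(4) C.subset .
    fix g assume g: "g \<in> carrier F" "g \<notin> C"
    consider "c = \<one>\<^bsub>F\<^esub>" | "g \<otimes>\<^bsub>F\<^esub> c \<noteq> c \<otimes>\<^bsub>F\<^esub> g"
      | "c \<noteq> \<one>\<^bsub>F\<^esub>" "g \<otimes>\<^bsub>F\<^esub> c = c \<otimes>\<^bsub>F\<^esub> g"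
      by blast
    then show "\<exists>p\<in>coprime_primes L. \<exists>N. p_power_index F p N \<and> (\<forall>h\<in>C. h \<otimes>\<^bsub>F\<^esub> inv\<^bsub>F\<^esub> g \<notin> N)"
    proof cases
      \<comment> \<open>Here \<open>C\<close> is trivial, so it suffices that \<open>N\<close> omits
        the inverse of \<open>g\<close>.\<close>
      case 1
      then have "C = {\<one>\<^bsub>F\<^esub>}" using C by auto
      moreover have "inv\<^bsub>F\<^esub> g \<noteq> \<one>\<^bsub>F\<^esub>" using g C.one_closed by (metis F.inv_eq_1_iff)
      then obtain N where "p_power_index F p0 N" "inv\<^bsub>F\<^esub> g \<notin> N"
        using free_group_residually_p[OF p0(2)] g F.inv_closed unfolding F_def by blast
      ultimately show ?thesis using p0(1) g by (intro bexI[of _ p0] exI[of _ N]) auto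
    next
      case 2
      let ?t = "(g \<otimes>\<^bsub>F\<^esub> c) \<otimes>\<^bsub>F\<^esub> inv\<^bsub>F\<^esub> (c \<otimes>\<^bsub>F\<^esub> g)"
      have "?t \<in> carrier F" using g cF by simp
      moreover have "?t \<noteq> \<one>\<^bsub>F\<^esub>"
        using 2 g cF by (metis F.inv_closed F.inv_equality F.inv_inv F.m_closed)
      ultimately obtain N where N: "p_power_index F p0 N" "?t \<notin> N"
        using free_group_residually_p[OF p0(2)] unfolding F_def by blast
      have "h \<otimes>\<^bsub>F\<^esub> inv\<^bsub>F\<^esub> g \<notin> N" if hC: "h \<in> C" for h
      proof -
        obtain i :: int where i: "h = c [^]\<^bsub>F\<^esub> i" using C hC by blast
        have "h \<otimes>\<^bsub>F\<^esub> c = c \<otimes>\<^bsub>F\<^esub> h"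
          using F.int_pow_mult[OF cF, of i 1] F.int_pow_mult[OF cF, of 1 i] cF
          by (simp add: i add.commute)
        from F.commutator_separates[OF N(1) g(1) cF C.mem_carrier[OF hC] this] show ?thesis
          using N(2) by blast
      qed
      then show ?thesis using p0(1) N(1) by blast
    next
      case 3
      obtain r k m where r: "r \<in> carrier F"
        and gr: "g = r [^]\<^bsub>F\<^esub> (k :: int)" and cr: "c = r [^]\<^bsub>F\<^esub> (m :: int)"
        using free_group_commuting cF g(1) 3 unfolding F_def by blast
      have r1: "r \<noteq> \<one>\<^bsub>F\<^esub>" using cr 3(1) by auto
      have m0: "m \<noteq> 0" using cr 3(1) by auto
      have C_r: "\<exists>i. h = r [^]\<^bsub>F\<^esub> (m * i)" if "h \<in> C" for h
        using that C r by (auto simp: cr F.int_pow_pow)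
      have "\<not> m dvd k"
      proof
        assume "m dvd k"
        then obtain i where "k = m * i" by blast
        then have "g = c [^]\<^bsub>F\<^esub> i" using r by (simp add: gr cr F.int_pow_pow)
        then show False using g(2) C by blast
      qed
      then obtain q a where q: "prime q" "int (q ^ a) dvd m" "\<not> int (q ^ a) dvd k"
        using int_dvd_primepowI[OF m0] by blast
      \<comment> \<open>Otherwise the power of \<open>r\<close> with exponent \<open>m / q\<close>
        is a \<open>q\<close>-th root of \<open>c\<close>, hence lies in \<open>C\<close> and equals
        a power with exponent \<open>m * i\<close>. Torsion-freeness gives
        \<open>m = q * m * i\<close>, so \<open>q\<close> would be a unit.\<close>
      have "q \<notin> L"
      proof
        assume "q \<in> L"
        have "a \<noteq> 0" using q(3) by (cases a) auto
        then have "int q dvd int (q ^ a)" by (simp add: dvd_power)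
        then obtain j where j: "m = j * int q" using q(2) by (metis dvd_trans dvdE mult.commute)
        have "(r [^]\<^bsub>F\<^esub> j) [^]\<^bsub>F\<^esub> q = c"
          using r by (simp add: cr j F.int_pow_pow flip: int_pow_int)
        moreover have "r [^]\<^bsub>F\<^esub> j \<in> carrier F" using r by simp
        ultimately have "r [^]\<^bsub>F\<^esub> j \<in> C"
          using assms(5) \<open>q \<in> L\<close> c by (simp add: closed_under_roots_def F_def)
        then obtain i where "r [^]\<^bsub>F\<^esub> j = r [^]\<^bsub>F\<^esub> (m * i)" using C_r by blast
        then have "r [^]\<^bsub>F\<^esub> (j - m * i) = \<one>\<^bsub>F\<^esub>" using r by (simp add: F.int_pow_diff)
        then have "j = m * i"
          using free_group_torsion_free r r1 unfolding F_def by fastforce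
        then have "int q * i = 1" using j m0 by auto
        then show False using q(1) by (auto simp: zmult_eq_1_iff)
      qed
      then have "gcd q l = 1" if "l \<in> L" for l
        using primes_coprime[of q l] q(1) assms(3) that by (metis coprime_imp_gcd_eq_1)
      then have qP: "q \<in> coprime_primes L"
        using q(1) by (simp add: coprime_primes_def)
      obtain N where N: "p_power_index F q N"
        "\<And>e :: int. r [^]\<^bsub>F\<^esub> e \<in> N \<Longrightarrow> int (q ^ a) dvd e"
        by (rule free_group_residual_order[OF q(1) r[unfolded F_def] r1[unfolded F_def],
              folded F_def, of a]) blast
      \<comment> \<open>Exponents of elements of \<open>C\<close> are multiples of \<open>m\<close>,
        hence of \<open>q ^ a\<close>. Agreement of \<open>h\<close> and \<open>g\<close> modulo
        \<open>N\<close> would make \<open>k\<close> a multiple of \<open>q ^ a\<close> too.\<close>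
      have "h \<otimes>\<^bsub>F\<^esub> inv\<^bsub>F\<^esub> g \<notin> N" if "h \<in> C" for h
      proof
        assume *: "h \<otimes>\<^bsub>F\<^esub> inv\<^bsub>F\<^esub> g \<in> N"
        obtain i where "h = r [^]\<^bsub>F\<^esub> (m * i)" using C_r[OF \<open>h \<in> C\<close>] by blast
        then have "r [^]\<^bsub>F\<^esub> (m * i - k) \<in> N" using * r by (simp add: gr F.int_pow_diff)
        then have "int (q ^ a) dvd m * i - k" by (rule N(2))
        from dvd_diff[OF dvd_mult2[OF q(2), of i] this] show False using q(3) by simp
      qed
      then show ?thesis using qP N(1) by blast
    qed
  qed
  then show ?thesis by (simp add: F_def)
qed

end
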